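(* Let $D>E\ge2$ be integers, and consider a system consisting of one form of degree $D$ and one form of degree $E$, that is, $r_D=r_E=1$ and $r_d=0$ for all other $d\le D$. Then $$n_0=(2+E)(D-1)2^{D-1}+E2^{E-1}.$$
   Context: For non-negative integers $r_1,\dots,r_D$ with $r_D\ge1$ (where $r_d$ is the number of forms of degree $d$ in a system) put $\Delta=\{d:r_d\ge1\}$, $\mathcal{D}_j=r_1+2r_2+\dots+jr_j$ for $1\le j\le D$, $\mathcal{D}_0=0$, and $$t_d=\sum_{k=d}^D2^{k-1}(k-1)r_k\quad(1\le d\le D+1),\qquad n_0(d)=\mathcal{D}_d\left(2^{d-1}+t_{d+1}\right)+t_{d+1}+\sum_{j=d+1}^Dt_jr_j,$$ $$n_0=\max\{n_0(d):d\in\Delta\cup\{0\}\},$$ with empty sums equal to $0$. *)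

theory Defs
  imports Main
begin

text \<open>
  A system of forms is represented by its top degree \<open>D\<close> and the function \<open>r\<close>, where \<open>r d\<close>
  is the number of forms of degree \<open>d\<close> for \<open>1 \<le> d \<le> D\<close>. The values of \<open>r\<close> outside this range
  are irrelevant to all quantities below.
\<close>

definition degs :: "nat \<Rightarrow> (nat \<Rightarrow> nat) \<Rightarrow> nat set" where
  "degs D r = {d \<in> {1..D}. r d \<ge> 1}"

definition cum_deg :: "(nat \<Rightarrow> nat) \<Rightarrow> nat \<Rightarrow> nat" where
  "cum_deg r j = (\<Sum>i=1..j. i * r i)"

definition t :: "nat \<Rightarrow> (nat \<Rightarrow> nat) \<Rightarrow> nat \<Rightarrow> nat" where
  "t D r d = (\<Sum>k=d..D. 2 ^ (k - 1) * (k - 1) * r k)"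

text \<open>
  In \<open>t\<close> the argument \<open>d\<close> is always at least 1, so the subtractions \<open>k - 1\<close> are exact.
  In \<open>n0_at\<close> the subtraction \<open>d - 1\<close> truncates only for \<open>d = 0\<close>, where the term \<open>2 ^ (d - 1)\<close>
  is multiplied by \<open>cum_deg r 0 = 0\<close> and hence does not contribute.
\<close>

definition n0_at :: "nat \<Rightarrow> (nat \<Rightarrow> nat) \<Rightarrow> nat \<Rightarrow> nat" where
  "n0_at D r d =
     cum_deg r d * (2 ^ (d - 1) + t D r (d + 1)) + t D r (d + 1) + (\<Sum>j=d+1..D. t D r j * r j)"

definition n0 :: "nat \<Rightarrow> (nat \<Rightarrow> nat) \<Rightarrow> nat" where
  "n0 D r = Max (n0_at D r ` (degs D r \<union> {0}))"

end

theory Submission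
  imports Defs
begin

text \<open>
  With \<open>A = 2 ^ (D - 1) * (D - 1)\<close> and \<open>B = 2 ^ (E - 1) * (E - 1)\<close> the value of \<open>t\<^sub>d\<close> is \<open>A + B\<close> for
  \<open>d \<le> E\<close>, \<open>A\<close> for \<open>E < d \<le> D\<close>, and \<open>0\<close> beyond \<open>D\<close>. The maximum defining \<open>n\<^sub>0\<close> therefore
  runs over only three numbers,
  \<open>n\<^sub>0(0) = 3 A + 2 B\<close>, \<open>n\<^sub>0(E) = (2 + E) A + E 2 ^ (E - 1)\<close> and \<open>n\<^sub>0(D) = (D + E) 2 ^ (D - 1)\<close>,
  and the middle one is the largest. It dominates \<open>n\<^sub>0(D)\<close> because
  \<open>(2 + E) (D - 1) - (D + E) = (E + 1) (D - 2) \<ge> 0\<close>. It dominates \<open>n\<^sub>0(0)\<close> because its surplus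
  \<open>(E - 1) A\<close> alone covers \<open>2 B\<close>: as \<open>D > E\<close>, doubling \<open>2 ^ (E - 1)\<close> does not exceed
  \<open>2 ^ (D - 1)\<close>, so \<open>A \<ge> 2 \<cdot> 2 ^ (E - 1)\<close>.
\<close>

text \<open>
  The quantities \<open>\<D>\<^sub>j\<close>, \<open>t\<^sub>d\<close> and the last sum in \<open>n\<^sub>0(d)\<close> are all sums of one weight per form, so
  each is evaluated by recording which of the two degrees lie in the range of summation.
\<close>

lemma sum_over_two_degrees:
  fixes r f :: "nat \<Rightarrow> nat"
  assumes "E < D" and "r D = 1" and "r E = 1"
    and zero: "\<forall>d\<in>{1..D} - {D, E}. r d = 0"
    and "1 \<le> a" and "b \<le> D"
  shows "(\<Sum>k=a..b. f k * r k)
    = (if E \<in> {a..b} then f E else 0) + (if D \<in> {a..b} then f D else 0)"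
proof -
  have "(\<Sum>k=a..b. f k * r k)
      = (\<Sum>k=a..b. (if k = E then f E else 0) + (if k = D then f D else 0))"
  proof (rule sum.cong)
    fix k assume "k \<in> {a..b}"
    then have "1 \<le> k" "k \<le> D"
      using assms(5,6) by auto
    then show "f k * r k = (if k = E then f E else 0) + (if k = D then f D else 0)"
      using assms(1-3) zero by auto
  qed simp
  also have "\<dots> = (if E \<in> {a..b} then f E else 0) + (if D \<in> {a..b} then f D else 0)"
    by (simp add: sum.distrib)
  finally show ?thesis .
qed

lemma degs_two_degrees:
  assumes "1 \<le> E" and "E < D" and "r D = 1" and "r E = 1"
    and zero: "\<forall>d\<in>{1..D} - {D, E}. r d = 0"
  shows "degs D r = {D, E}"
proof (rule set_eqI)
  fix d
  show "d \<in> degs D r \<longleftrightarrow> d \<in> {D, E}"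
  proof (cases "d = D \<or> d = E")
    case True
    then show ?thesis
      using assms(1-4) by (auto simp: degs_def)
  next
    case False
    then show ?thesis
      using zero by (auto simp: degs_def)
  qed
qed

lemma n0_at_two_degrees:
  fixes r :: "nat \<Rightarrow> nat"
  assumes "1 \<le> E" and "E < D" and "r D = 1" and "r E = 1"
    and zero: "\<forall>d\<in>{1..D} - {D, E}. r d = 0"
  defines "A \<equiv> 2 ^ (D - 1) * (D - 1)" and "B \<equiv> 2 ^ (E - 1) * (E - 1)"
  shows "n0_at D r 0 = 3 * A + 2 * B"
    and "n0_at D r E = (2 + E) * A + E * 2 ^ (E - 1)"
    and "n0_at D r D = (D + E) * 2 ^ (D - 1)"
proof -
  note two = sum_over_two_degrees[OF assms(2-4) zero]
  have t: "t D r a = (if a \<le> E then B else 0) + (if a \<le> D then A else 0)" if "1 \<le> a" for a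
    using two[OF that le_refl, of "\<lambda>k. 2 ^ (k - 1) * (k - 1)"] assms(2)
    by (simp add: t_def A_def B_def)
  have c: "cum_deg r b = (if E \<le> b then E else 0) + (if D \<le> b then D else 0)" if "b \<le> D" for b
    using two[OF le_refl that, of "\<lambda>k. k"] assms(1,2)
    by (simp add: cum_deg_def)
  have s: "(\<Sum>j=a..D. t D r j * r j)
      = (if a \<le> E then t D r E else 0) + (if a \<le> D then t D r D else 0)" if "1 \<le> a" for a
    using two[OF that le_refl, of "t D r"] assms(2) by simp
  show "n0_at D r 0 = 3 * A + 2 * B"
    using assms(1,2) s[of 1] by (simp add: n0_at_def c t)
  show "n0_at D r E = (2 + E) * A + E * 2 ^ (E - 1)"
    using assms(1,2) s[of "E + 1"] by (simp add: n0_at_def c t algebra_simps)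
  show "n0_at D r D = (D + E) * 2 ^ (D - 1)"
    using assms(1,2) by (simp add: n0_at_def c t)
qed

theorem corollary1p5:
  fixes D E :: nat and r :: "nat \<Rightarrow> nat"
  assumes "D > E" and "E \<ge> 2"
    and "r D = 1" and "r E = 1"
    and "\<And>d. 1 \<le> d \<Longrightarrow> d \<le> D \<Longrightarrow> d \<noteq> D \<Longrightarrow> d \<noteq> E \<Longrightarrow> r d = 0"
  shows "n0 D r = (2 + E) * (D - 1) * 2 ^ (D - 1) + E * 2 ^ (E - 1)"
proof -
  define A B where "A = 2 ^ (D - 1) * (D - 1)" and "B = 2 ^ (E - 1) * (E - 1)"
  have "1 \<le> E"
    using assms(2) by simp
  have zero: "\<forall>d\<in>{1..D} - {D, E}. r d = 0"
    using assms(5) by simp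
  note deg = degs_two_degrees[OF \<open>1 \<le> E\<close> assms(1,3,4) zero]
    and vals = n0_at_two_degrees[OF \<open>1 \<le> E\<close> assms(1,3,4) zero, folded A_def B_def]
  have D_le_E: "n0_at D r D \<le> n0_at D r E"
  proof -
    obtain m where m: "D = m + 2"
      using assms(1,2) by (metis add.commute le_Suc_ex less_imp_le order.trans)
    have "D + E \<le> (2 + E) * (D - 1)"
      by (simp add: m algebra_simps)
    then have "(D + E) * 2 ^ (D - 1) \<le> (2 + E) * (D - 1) * 2 ^ (D - 1)"
      by (rule mult_le_mono1)
    also have "\<dots> = (2 + E) * A"
      by (simp only: A_def mult_ac)
    finally show ?thesis
      unfolding vals by linarith
  qed
  have zero_le_E: "n0_at D r 0 \<le> n0_at D r E"
  proof -
    have "2 * 2 ^ (E - 1) = (2::nat) ^ E"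
      using assms(2) by (simp flip: power_Suc)
    also have "\<dots> \<le> 2 ^ (D - 1)"
      using assms(1) by (intro power_increasing) auto
    also have "\<dots> \<le> A"
      using assms(1,2) by (simp add: A_def)
    finally have "2 * 2 ^ (E - 1) * (E - 1) \<le> A * (E - 1)"
      by (rule mult_le_mono1)
    then have "3 * A + 2 * B \<le> 3 * A + A * (E - 1)"
      by (simp add: B_def)
    also have "\<dots> = (2 + E) * A"
      using assms(2) by (cases E) (auto simp: algebra_simps)
    finally show ?thesis
      unfolding vals by linarith
  qed
  have "n0 D r = n0_at D r E"
    unfolding n0_def deg by (rule Max_eqI) (use D_le_E zero_le_E in auto)
  then show ?thesis
    by (simp only: vals A_def mult_ac)
qed

end
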